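(* Let $S^1,S^2\in\mathfrak{sl}(2,\mathbb{R})$ with $\det(S^1)=\det(S^2)=0$ and $[S^1,S^2]\neq0$. Let $\mathcal{T}_S$ denote the factorization cost for $\{\pm S^1,\pm S^2\}$. Then there exist $\lambda>0$ and an automorphism $\sigma\colon SL(2,\mathbb{R})\to SL(2,\mathbb{R})$ such that $\mathcal{T}_S(g)=\lambda\,\mathcal{T}(\sigma(g))$ for all $g\in SL(2,\mathbb{R})$.
   Context: $\mathfrak{sl}(2,\mathbb{R})$ is the set of real $2\times2$ matrices with zero trace, $[X,Y]=XY-YX$. $P=\begin{pmatrix}0&1\\0&0\end{pmatrix}$, $Q=\begin{pmatrix}0&0\\1&0\end{pmatrix}$. For $B_1,B_2\in\mathfrak{sl}(2,\mathbb{R})$ the factorization cost for $\{\pm B_1,\pm B_2\}$ is the function on $SL(2,\mathbb{R})$ $$g\mapsto\inf\Big\{\sum_{i=1}^k|t_i| : g=\exp(t_1A_1)\cdots\exp(t_kA_k),\ k\in\mathbb{N},\ t_i\in\mathbb{R},\ A_i\in\{B_1,B_2\}\Big\}.$$ $\mathcal{T}$ denotes the factorization cost for $\{\pm P,\pm Q\}$. *)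

theory Defs
  imports "HOL-Analysis.Analysis" "HOL-Algebra.Group"
begin

definition SL2 :: "(real^2^2) monoid" where
  "SL2 = \<lparr>carrier = {A. det A = 1}, mult = (**), one = mat 1\<rparr>"

definition sl2 :: "(real^2^2) set" where
  "sl2 = {X. trace X = 0}"

definition lie_bracket :: "real^2^2 \<Rightarrow> real^2^2 \<Rightarrow> real^2^2" where
  "lie_bracket X Y = X ** Y - Y ** X"

definition P :: "real^2^2" where
  "P = vector [vector [0, 1], vector [0, 0]]"

definition Q :: "real^2^2" where
  "Q = vector [vector [0, 0], vector [1, 0]]"

text \<open>The library's power, one and exponential on the type \<^typ>\<open>real^2^2\<close> do not give matrix
  powers: its multiplication \<open>*\<close> is componentwise. Hence the iteration of \<open>**\<close> and the explicit
  exponential series; lemma \<open>summable_matrix_exp\<close> below shows that the series always converges.\<close>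

definition matrix_exp :: "real^2^2 \<Rightarrow> real^2^2" where
  "matrix_exp A = (\<Sum>n. (((**) A ^^ n) (mat 1)) /\<^sub>R fact n)"

text \<open>A word \<open>[(t\<^sub>1, A\<^sub>1), \<dots>, (t\<^sub>k, A\<^sub>k)]\<close> stands for the factorization
  \<open>exp (t\<^sub>1 A\<^sub>1) \<cdots> exp (t\<^sub>k A\<^sub>k)\<close>; the empty word has product \<^term>\<open>mat 1 :: real^2^2\<close>.\<close>

definition word_prod :: "(real \<times> (real^2^2)) list \<Rightarrow> real^2^2" where
  "word_prod w = foldr (\<lambda>(t, A) M. matrix_exp (t *\<^sub>R A) ** M) w (mat 1)"

definition word_cost :: "(real \<times> (real^2^2)) list \<Rightarrow> real" where
  "word_cost w = (\<Sum>(t, A)\<leftarrow>w. \<bar>t\<bar>)"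

text \<open>Values are extended reals, so that a matrix admitting no factorization has cost \<open>\<infinity>\<close>.
  The signs in \<open>{\<plusminus>B1, \<plusminus>B2}\<close> are accounted for by the coefficients \<open>t\<close> ranging over all reals.\<close>

definition factorization_cost :: "real^2^2 \<Rightarrow> real^2^2 \<Rightarrow> real^2^2 \<Rightarrow> ereal" where
  "factorization_cost B1 B2 g =
     Inf {ereal (word_cost w) |w. snd ` set w \<subseteq> {B1, B2} \<and> g = word_prod w}"

lemma group_SL2: "group SL2"
proof (rule groupI)
  fix x assume "x \<in> carrier SL2"
  then have x: "det x = 1" by (simp add: SL2_def)
  then obtain y where y: "y ** x = mat 1"
    using invertible_det_nz[of x] invertible_left_inverse[of x] by auto
  have "det y * det x = 1" using arg_cong[OF y, of det] by (simp only: det_mul det_I)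
  with x y show "\<exists>y\<in>carrier SL2. y \<otimes>\<^bsub>SL2\<^esub> x = \<one>\<^bsub>SL2\<^esub>"
    by (auto simp: SL2_def)
qed (auto simp: SL2_def det_mul matrix_mul_assoc)

lemma summable_matrix_exp:
  fixes A :: "real^2^2"
  shows "summable (\<lambda>n. (((**) A ^^ n) (mat 1)) /\<^sub>R fact n)"
proof -
  have lin: "linear (\<lambda>B :: real^2^2. A ** B)"
    by (rule linearI) (simp_all only: matrix_add_ldistrib matrix_scalar_ac scalar_matrix_assoc)
  obtain K where K: "K > 0" "\<And>B :: real^2^2. norm (A ** B) \<le> K * norm B"
    using linear_bounded_pos[OF lin] by auto
  have "norm (((**) A ^^ n) (mat 1)) \<le> K ^ n * norm (mat 1 :: real^2^2)" for n
  proof (induction n)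
    case (Suc n)
    have "norm (((**) A ^^ Suc n) (mat 1)) \<le> K * norm (((**) A ^^ n) (mat 1))"
      using K(2) by simp
    also have "\<dots> \<le> K * (K ^ n * norm (mat 1 :: real^2^2))"
      using Suc K(1) by (intro mult_left_mono) auto
    finally show ?case by (simp add: mult.assoc)
  qed simp
  then have "norm ((((**) A ^^ n) (mat 1)) /\<^sub>R fact n) \<le> (K ^ n /\<^sub>R fact n) * norm (mat 1 :: real^2^2)" for n
    by (simp add: divide_simps)
  moreover have "summable (\<lambda>n. (K ^ n /\<^sub>R fact n) * norm (mat 1 :: real^2^2))"
    by (intro summable_mult2 summable_exp_generic)
  ultimately show ?thesis
    by (meson summable_comparison_test')
qed

end

theory Submission
  imports Defs
begin

text \<open>A matrix in \<open>sl2\<close> with determinant \<open>0\<close> squares to \<open>0\<close>. Two such matrices \<open>S1\<close>, \<open>S2\<close> that do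
  not commute have \<open>trace (S1 ** S2) = c \<noteq> 0\<close>, and they satisfy \<open>S1 S2 + S2 S1 = c I\<close>. Hence a
  nonzero vector \<open>u\<close> in the kernel of \<open>S1\<close> and its image \<open>S2 u\<close> form a basis in which \<open>S1\<close> and \<open>S2\<close>
  are multiples of \<open>P\<close> and \<open>Q\<close>; stretching the second basis vector shares the factor \<open>c\<close> between
  the two, so that both multiples have absolute value \<open>\<surd>\<bar>c\<bar>\<close> (lemma
  \<open>nilpotent_pair_normal_form\<close>).

  Let \<open>T\<close> be the matrix of this basis. Conjugation by \<open>T\<close> commutes with the exponential, so it turns
  a factorization of \<open>g\<close> into one of \<open>T\<^sup>-\<^sup>1 g T\<close>, letter by letter, each coefficient being multiplied
  by \<open>\<plusminus>\<surd>\<bar>c\<bar>\<close>; the sign is irrelevant for the cost. The same holds in the opposite direction, and the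
  two inequalities of lemma \<open>factorization_cost_conj_scale_le\<close> give the claim with \<open>\<sigma>\<close> the
  conjugation by \<open>T\<close> and \<open>\<lambda> = 1 / \<surd>\<bar>c\<bar>\<close>.\<close>

section \<open>Conjugation, the exponential and the cost\<close>

lemma matrix_mult_inverse_cancel:
  fixes T :: "real^'n^'n"
  assumes "T' ** T = mat 1"
  shows "T' ** (T ** A) = A"
  by (simp add: matrix_mul_assoc assms)

lemma matrix_power_conj:
  fixes T T' A :: "real^'n^'n"
  assumes "T ** T' = mat 1" and "T' ** T = mat 1"
  shows "((**) (T ** A ** T') ^^ n) (mat 1) = T ** ((**) A ^^ n) (mat 1) ** T'"
proof (induction n)
  case 0
  then show ?case by (simp add: assms)
next
  case (Suc n)
  then show ?case
    by (simp add: matrix_mul_assoc[symmetric] matrix_mult_inverse_cancel[OF assms(2)])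
qed

lemma bounded_linear_matrix_mult_both:
  fixes T T' :: "real^'n^'n"
  shows "bounded_linear (\<lambda>X. T ** X ** T')"
proof -
  have "linear (\<lambda>X. T ** X ** T')"
    by (rule linearI)
      (simp_all add: matrix_add_ldistrib matrix_matrix_mult_def vec_eq_iff sum.distrib
        sum_distrib_left algebra_simps)
  then show ?thesis by (simp add: linear_conv_bounded_linear)
qed

lemma matrix_exp_conj:
  assumes "T ** T' = mat 1" and "T' ** T = mat 1"
  shows "matrix_exp (T ** A ** T') = T ** matrix_exp A ** T'"
proof -
  interpret bounded_linear "\<lambda>X. T ** X ** T'" by (rule bounded_linear_matrix_mult_both)
  have "T ** matrix_exp A ** T' = (\<Sum>n. T ** ((((**) A ^^ n) (mat 1)) /\<^sub>R fact n) ** T')"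
    unfolding matrix_exp_def by (rule suminf[OF summable_matrix_exp])
  also have "\<dots> = (\<Sum>n. (T ** (((**) A ^^ n) (mat 1)) ** T') /\<^sub>R fact n)"
    by (simp only: scaleR)
  also have "\<dots> = matrix_exp (T ** A ** T')"
    unfolding matrix_exp_def by (simp only: matrix_power_conj[OF assms])
  finally show ?thesis by simp
qed

text \<open>Each letter \<open>(t, B)\<close> with \<open>B = c T A T\<^sup>-\<^sup>1\<close> becomes \<open>(t c, A)\<close>; the inner factors \<open>T\<close>, \<open>T\<^sup>-\<^sup>1\<close>
  between consecutive letters cancel.\<close>

lemma word_transport:
  assumes inv: "T ** T' = mat 1" "T' ** T = mat 1"
    and gen: "\<And>B. B \<in> \<B> \<Longrightarrow> \<exists>A\<in>\<A>. \<exists>c. \<bar>c\<bar> = k \<and> B = c *\<^sub>R (T ** A ** T')"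
    and "snd ` set w \<subseteq> \<B>"
  shows "\<exists>w'. snd ` set w' \<subseteq> \<A> \<and> word_prod w = T ** word_prod w' ** T' \<and>
    word_cost w' = k * word_cost w"
  using assms(4)
proof (induction w)
  case Nil
  then show ?case
    by (intro exI[of _ "[]"]) (simp add: word_prod_def word_cost_def inv)
next
  case (Cons b w)
  obtain t B where b: "b = (t, B)" by force
  from Cons.prems b obtain A c where A: "A \<in> \<A>" "\<bar>c\<bar> = k" "B = c *\<^sub>R (T ** A ** T')"
    using gen[of B] by auto
  from Cons obtain w' where w': "snd ` set w' \<subseteq> \<A>" "word_prod w = T ** word_prod w' ** T'"
    "word_cost w' = k * word_cost w" by auto
  interpret bounded_linear "\<lambda>X. T ** X ** T'" by (rule bounded_linear_matrix_mult_both)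
  have "t *\<^sub>R B = T ** ((t * c) *\<^sub>R A) ** T'" by (simp only: A scaleR scaleR_scaleR)
  then have exp: "matrix_exp (t *\<^sub>R B) = T ** matrix_exp ((t * c) *\<^sub>R A) ** T'"
    by (simp only: matrix_exp_conj[OF inv])
  have "word_prod (b # w) = T ** word_prod ((t * c, A) # w') ** T'"
    using w'(2) exp
    by (simp add: b word_prod_def matrix_mul_assoc[symmetric] matrix_mult_inverse_cancel[OF inv(2)])
  moreover have "word_cost ((t * c, A) # w') = k * word_cost (b # w)"
    using w'(3) A(2) by (simp add: b word_cost_def abs_mult algebra_simps)
  ultimately show ?case
    using w'(1) A(1) by (intro exI[of _ "(t * c, A) # w'"]) auto
qed

lemma factorization_cost_conj_scale_le:
  assumes inv: "T ** T' = mat 1" "T' ** T = mat 1" and "k > 0"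
    and gen: "\<And>B. B \<in> {B1, B2} \<Longrightarrow> \<exists>A\<in>{A1, A2}. \<exists>c. \<bar>c\<bar> = k \<and> B = c *\<^sub>R (T ** A ** T')"
  shows "ereal (1 / k) * factorization_cost A1 A2 (T' ** g ** T) \<le> factorization_cost B1 B2 g"
  unfolding factorization_cost_def[of B1 B2]
proof (rule Inf_greatest, clarify)
  fix w assume w: "snd ` set w \<subseteq> {B1, B2}" "g = word_prod w"
  obtain w' where w': "snd ` set w' \<subseteq> {A1, A2}" "word_prod w = T ** word_prod w' ** T'"
    "word_cost w' = k * word_cost w"
    using word_transport[OF inv gen w(1)] by blast
  have "T' ** word_prod w ** T = word_prod w'"
    using w'(2) by (simp add: matrix_mul_assoc[symmetric] matrix_mult_inverse_cancel[OF inv(2)] inv)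
  then have "factorization_cost A1 A2 (T' ** word_prod w ** T) \<le> ereal (word_cost w')"
    unfolding factorization_cost_def using w'(1) by (intro Inf_lower) auto
  then have "ereal (1 / k) * factorization_cost A1 A2 (T' ** word_prod w ** T)
      \<le> ereal (1 / k) * ereal (word_cost w')"
    using \<open>k > 0\<close> by (intro ereal_mult_left_mono) auto
  then show "ereal (1 / k) * factorization_cost A1 A2 (T' ** word_prod w ** T) \<le> ereal (word_cost w)"
    using w'(3) \<open>k > 0\<close> by simp
qed

text \<open>The reverse inequality is the same lemma for \<open>T\<^sup>-\<^sup>1\<close> and \<open>1 / k\<close>, with the two pairs of
  generators exchanged.\<close>

lemma factorization_cost_conj_scale:
  assumes inv: "T ** T' = mat 1" "T' ** T = mat 1"
    and k: "k > 0" "\<bar>\<alpha>\<bar> = k" "\<bar>\<beta>\<bar> = k"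
  shows "factorization_cost (\<alpha> *\<^sub>R (T ** A1 ** T')) (\<beta> *\<^sub>R (T ** A2 ** T')) g =
    ereal (1 / k) * factorization_cost A1 A2 (T' ** g ** T)" (is "?cB = _ * ?cA")
proof (rule antisym)
  let ?B1 = "\<alpha> *\<^sub>R (T ** A1 ** T')" and ?B2 = "\<beta> *\<^sub>R (T ** A2 ** T')"
  show "ereal (1 / k) * ?cA \<le> ?cB"
    using k by (intro factorization_cost_conj_scale_le[OF inv]) auto
  interpret bounded_linear "\<lambda>X. T' ** X ** T" by (rule bounded_linear_matrix_mult_both)
  have undo: "T' ** (T ** X ** T') ** T = X" for X
    by (simp add: matrix_mul_assoc[symmetric] matrix_mult_inverse_cancel[OF inv(2)] inv)
  have "A1 = (1 / \<alpha>) *\<^sub>R (T' ** ?B1 ** T)" "A2 = (1 / \<beta>) *\<^sub>R (T' ** ?B2 ** T)"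
    using k by (auto simp only: scaleR undo scaleR_scaleR) auto
  moreover have "\<bar>1 / \<alpha>\<bar> = 1 / k" "\<bar>1 / \<beta>\<bar> = 1 / k"
    using k by (auto simp: abs_divide)
  ultimately have "\<exists>B\<in>{?B1, ?B2}. \<exists>c. \<bar>c\<bar> = 1 / k \<and> A = c *\<^sub>R (T' ** B ** T)" if "A \<in> {A1, A2}" for A
    using that by (metis insertE insertI1 insertI2 singletonD)
  then have "ereal (1 / (1 / k)) * factorization_cost ?B1 ?B2 (T ** (T' ** g ** T) ** T') \<le> ?cA"
    using k(1) by (intro factorization_cost_conj_scale_le[OF inv(2,1)]) auto
  then have "ereal k * ?cB \<le> ?cA"
    by (simp add: matrix_mul_assoc[symmetric] matrix_mult_inverse_cancel[OF inv(1)] inv)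
  then have "ereal (1 / k) * (ereal k * ?cB) \<le> ereal (1 / k) * ?cA"
    using k(1) by (intro ereal_mult_left_mono) auto
  then show "?cB \<le> ereal (1 / k) * ?cA"
    using k(1) by (simp add: mult.assoc[symmetric])
qed

lemma conj_iso_SL2:
  fixes T T' :: "real^2^2"
  assumes inv: "T ** T' = mat 1" "T' ** T = mat 1"
  shows "(\<lambda>g. T' ** g ** T) \<in> iso SL2 SL2"
proof -
  have d: "det T * det T' = 1"
    using arg_cong[OF inv(1), of det] by (simp only: det_mul det_I)
  have "bij_betw (\<lambda>g. T' ** g ** T) (carrier SL2) (carrier SL2)"
    by (rule bij_betw_byWitness[where f' = "\<lambda>g. T ** g ** T'"])
      (use d in \<open>auto simp: SL2_def det_mul matrix_mul_assoc[symmetric] inv mult.commute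
        matrix_mult_inverse_cancel[OF inv(1)] matrix_mult_inverse_cancel[OF inv(2)]\<close>)
  moreover have "(\<lambda>g. T' ** g ** T) \<in> hom SL2 SL2"
    using d by (auto simp: hom_def SL2_def det_mul matrix_mul_assoc[symmetric] mult.commute
        matrix_mult_inverse_cancel[OF inv(1)])
  ultimately show ?thesis by (simp add: iso_def)
qed

section \<open>Normal form of a noncommuting nilpotent pair\<close>

lemma sl2_entries:
  assumes "X \<in> sl2"
  shows "X $ 2 $ 2 = - X $ 1 $ 1"
  using assms by (simp add: sl2_def trace_def sum_2)

text \<open>The polarization of \<open>X ** X = - det X \<cdot> mat 1\<close>, which is Cayley--Hamilton for trace zero.\<close>

lemma sl2_anticommutator:
  assumes "X \<in> sl2" and "Y \<in> sl2"
  shows "X ** Y + Y ** X = trace (X ** Y) *\<^sub>R mat 1"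
  using sl2_entries[OF assms(1)] sl2_entries[OF assms(2)]
  by (simp add: vec_eq_iff forall_2 matrix_matrix_mult_def sum_2 trace_def mat_def)

lemma sl2_det_zero_square:
  assumes "X \<in> sl2" and "det X = 0"
  shows "X ** X = 0"
  using sl2_entries[OF assms(1)] assms(2)
  by (simp add: vec_eq_iff forall_2 matrix_matrix_mult_def sum_2 det_2 algebra_simps)

text \<open>As polynomials in the entries of \<open>X\<close> and \<open>Y\<close>, the squares of the entries of the bracket lie in
  the ideal generated by \<open>det X\<close>, \<open>det Y\<close> and \<open>trace (X ** Y)\<close>.\<close>

lemma trace_mult_nonzero:
  assumes X: "X \<in> sl2" "det X = 0" and Y: "Y \<in> sl2" "det Y = 0"
    and "lie_bracket X Y \<noteq> 0"
  shows "trace (X ** Y) \<noteq> 0"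
proof
  assume tr: "trace (X ** Y) = 0"
  define a b c d e f where ab: "a = X $ 1 $ 1" "b = X $ 1 $ 2" "c = X $ 2 $ 1"
    "d = Y $ 1 $ 1" "e = Y $ 1 $ 2" "f = Y $ 2 $ 1"
  note X22 = sl2_entries[OF X(1)] and Y22 = sl2_entries[OF Y(1)]
  have h: "a * a = - (b * c)" "d * d = - (e * f)" "2 * (a * d) + b * f + c * e = 0"
    using X(2) Y(2) tr X22 Y22
    by (simp_all add: ab det_2 trace_def matrix_matrix_mult_def sum_2 algebra_simps)
  have "(b * f - c * e)^2 = 0" "(a * e - b * d)^2 = 0" "(c * d - a * f)^2 = 0"
    using h by algebra+
  then have "b * f = c * e" "a * e = b * d" "c * d = a * f" by auto
  then have "lie_bracket X Y = 0"
    using X22 Y22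
    by (simp add: lie_bracket_def vec_eq_iff forall_2 matrix_matrix_mult_def sum_2 ab algebra_simps)
  with assms(5) show False by simp
qed

text \<open>Up to the stretching by \<open>k = \<surd>\<bar>c\<bar>\<close>, the basis is \<open>u\<close>, \<open>S2 u\<close> with \<open>u\<close> in the kernel of \<open>S1\<close>.
  The anticommutator gives \<open>S1 (S2 u) = c u\<close> with \<open>c \<noteq> 0\<close>; this makes the two vectors independent
  and makes \<open>S1\<close> act as a multiple of \<open>P\<close>.\<close>

lemma nilpotent_pair_normal_form:
  fixes S1 S2 :: "real^2^2"
  assumes S1: "S1 \<in> sl2" "det S1 = 0" and S2: "S2 \<in> sl2" "det S2 = 0"
    and br: "lie_bracket S1 S2 \<noteq> 0"
  obtains T T' \<alpha> \<beta> k where "T ** T' = mat 1" "T' ** T = mat 1" "k > 0" "\<bar>\<alpha>\<bar> = k" "\<bar>\<beta>\<bar> = k"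
    "S1 = \<alpha> *\<^sub>R (T ** P ** T')" "S2 = \<beta> *\<^sub>R (T ** Q ** T')"
proof -
  define c where "c = trace (S1 ** S2)"
  have c: "c \<noteq> 0" unfolding c_def by (rule trace_mult_nonzero[OF S1 S2 br])
  define k where "k = sqrt \<bar>c\<bar>"
  have k: "k > 0" "k * k = \<bar>c\<bar>" using c by (auto simp: k_def)
  have "S1 \<noteq> 0" using br by (auto simp: lie_bracket_def)
  then obtain v where v: "S1 *v v \<noteq> 0"
    by (metis matrix_eq matrix_vector_mult_0)
  \<comment> \<open>A nonzero vector in the image of \<open>S1\<close> lies in its kernel, as \<open>S1\<close> squares to zero.\<close>
  define u1 where "u1 = S1 *v v"
  define u2 where "u2 = (1 / k) *\<^sub>R (S2 *v u1)"
  have lin: "S *v (r *\<^sub>R x) = r *\<^sub>R (S *v x)" for S :: "real^2^2" and r x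
    by (simp add: matrix_vector_mult_scaleR)
  have square: "S1 *v (S1 *v x) = 0" "S2 *v (S2 *v x) = 0" for x
    by (simp_all add: matrix_vector_mul_assoc sl2_det_zero_square S1 S2)
  have u: "S1 *v u1 = 0" "S2 *v u2 = 0" "S2 *v u1 = k *\<^sub>R u2"
    using k(1) square by (simp_all add: u1_def u2_def lin)
  have "S1 *v (S2 *v u1) + S2 *v (S1 *v u1) = c *\<^sub>R u1"
    using arg_cong[OF sl2_anticommutator[OF S1(1) S2(1)], of "\<lambda>M. M *v u1"]
    by (simp add: c_def matrix_vector_mult_add_rdistrib matrix_vector_mul_assoc
        scaleR_matrix_vector_assoc[symmetric])
  then have u12: "S1 *v u2 = (c / k) *\<^sub>R u1"
    using u(1) by (simp add: u2_def lin)
  define T :: "real^2^2" where "T = (\<chi> i j. if j = 1 then u1 $ i else u2 $ i)"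
  have Tx: "T *v x = x $ 1 *\<^sub>R u1 + x $ 2 *\<^sub>R u2" for x
    by (simp add: T_def matrix_vector_mult_def vec_eq_iff sum_2 mult.commute)
  have "x = 0" if "T *v x = 0" for x
  proof -
    have 0: "x $ 1 *\<^sub>R u1 + x $ 2 *\<^sub>R u2 = 0" using that Tx by simp
    have "S1 *v (x $ 1 *\<^sub>R u1 + x $ 2 *\<^sub>R u2) = (x $ 2 * (c / k)) *\<^sub>R u1"
      by (simp add: matrix_vector_right_distrib lin u u12)
    then have "x $ 2 = 0" using 0 c k(1) v by (auto simp: u1_def)
    moreover from this have "x $ 1 = 0" using 0 v by (auto simp: u1_def)
    ultimately show ?thesis by (simp add: vec_eq_iff forall_2)
  qed
  then obtain T' where "T' ** T = mat 1"
    using matrix_left_invertible_ker[of T] by auto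
  then have inv: "T' ** T = mat 1" "T ** T' = mat 1"
    using matrix_left_right_inverse by auto
  have PQ: "P *v x = vector [x $ 2, 0]" "Q *v x = vector [0, x $ 1]" for x :: "real^2"
    by (simp_all add: P_def Q_def matrix_vector_mult_def vec_eq_iff forall_2 sum_2)
  have "S1 ** T = (c / k) *\<^sub>R (T ** P)" "S2 ** T = k *\<^sub>R (T ** Q)"
    by (simp_all add: matrix_eq matrix_vector_mul_assoc[symmetric] Tx PQ lin u u12
        matrix_vector_right_distrib scaleR_matrix_vector_assoc[symmetric] mult.commute)
  then have "S1 ** T ** T' = (c / k) *\<^sub>R (T ** P ** T')" "S2 ** T ** T' = k *\<^sub>R (T ** Q ** T')"
    by (simp_all add: scalar_matrix_assoc)
  then have "S1 = (c / k) *\<^sub>R (T ** P ** T')" "S2 = k *\<^sub>R (T ** Q ** T')"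
    by (simp_all add: matrix_mul_assoc[symmetric] inv)
  moreover have "\<bar>c / k\<bar> = k" "\<bar>k\<bar> = k" using k by (auto simp: abs_divide field_simps)
  ultimately show thesis using that inv k(1) by blast
qed

theorem theorem1p3:
  fixes S1 S2 :: "real^2^2"
  assumes "S1 \<in> sl2" and "S2 \<in> sl2"
    and "det S1 = 0" and "det S2 = 0"
    and "lie_bracket S1 S2 \<noteq> 0"
  shows "\<exists>(lam::real) \<sigma>. lam > 0 \<and> \<sigma> \<in> iso SL2 SL2 \<and>
    (\<forall>g \<in> carrier SL2.
       factorization_cost S1 S2 g = ereal lam * factorization_cost P Q (\<sigma> g))"
proof -
  obtain T T' \<alpha> \<beta> k where *: "T ** T' = mat 1" "T' ** T = mat 1" "k > 0" "\<bar>\<alpha>\<bar> = k" "\<bar>\<beta>\<bar> = k"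
    and S: "S1 = \<alpha> *\<^sub>R (T ** P ** T')" "S2 = \<beta> *\<^sub>R (T ** Q ** T')"
    using nilpotent_pair_normal_form[OF assms(1,3,2,4,5)] by metis
  have "factorization_cost S1 S2 g = ereal (1 / k) * factorization_cost P Q (T' ** g ** T)" for g
    unfolding S by (rule factorization_cost_conj_scale[OF *])
  moreover have "1 / k > 0" using *(3) by simp
  ultimately show ?thesis using conj_iso_SL2[OF *(1,2)] by blast
qed

end
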